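(* For $x>0$, let $\mathrm{SPFarey}_x$ be the set of all ratios $\frac{s}{t}$ where $s$ and $t$ are SP numbers with $s<t\le x$ and $\gcd(s,t)=1$, and let $\mathrm{SPFarey}(x)$ denote the cardinality of $\mathrm{SPFarey}_x$. Then, as $x\to\infty$, $$\mathrm{SPFarey}(x)=O\left(\frac{x^2}{(\log x)^2}\right).$$
   Context: An SP number (square-prime number) is a positive integer of the form $p\cdot a^2$ with $p$ prime and $a\ge 2$ an integer. The first few are $8,12,18,20,27,28,32,44,45,48,50,\dots$. *)

theory Defs
  imports
    Complex_Main
    "HOL-Computational_Algebra.Primes"
    "HOL-Library.Landau_Symbols"
begin

definition SP_number :: "nat \<Rightarrow> bool" where
  "SP_number n \<longleftrightarrow> (\<exists>p a. prime p \<and> a \<ge> 2 \<and> n = p * a ^ 2)"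

definition SPFarey_set :: "real \<Rightarrow> rat set" where
  "SPFarey_set x =
     {of_nat s / of_nat t | s t.
        SP_number s \<and> SP_number t \<and> s < t \<and> real t \<le> x \<and> coprime s t}"

definition SPFarey :: "real \<Rightarrow> nat" where
  "SPFarey x = card (SPFarey_set x)"

(* Hence the cardinality in SPFarey is never the junk value of an infinite set. *)
lemma finite_SPFarey_set: "finite (SPFarey_set x)"
proof (rule finite_subset)
  let ?N = "nat \<lfloor>x\<rfloor>"
  show "SPFarey_set x \<subseteq> (\<lambda>(s, t). of_nat s / of_nat t) ` ({..?N} \<times> {..?N})"
  proof
    fix r assume "r \<in> SPFarey_set x"
    then obtain s t :: nat where r: "r = of_nat s / of_nat t" and "s < t" "real t \<le> x"
      unfolding SPFarey_set_def by blast
    then have "t \<le> ?N" "s \<le> ?N" by linarith+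
    then show "r \<in> (\<lambda>(s, t). of_nat s / of_nat t) ` ({..?N} \<times> {..?N})"
      unfolding r by auto
  qed
qed simp

end

theory Submission
  imports Defs
begin

text \<open>
  A fraction in the set is determined by its numerator and denominator, so it suffices to
  show that there are \<open>O(x / ln x)\<close> SP numbers up to \<open>x\<close>, and to square this bound.

  An SP number up to \<open>x\<close> comes from a pair \<open>(p, a)\<close> with \<open>p\<close> prime and \<open>p * a\<^sup>2 \<le> x\<close>. These
  pairs are counted by splitting at \<open>p = x powr (1/4)\<close>. Since \<open>a \<le> sqrt x\<close>, there are at most
  \<open>x powr (3/4)\<close> pairs below the split (\<open>card_small_prime_pairs_le\<close>). In the remaining pairs
  \<open>ln p\<close> exceeds \<open>ln x / 4\<close>, so their number is at most \<open>4 / ln x\<close> times the sum of \<open>ln p\<close>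
  over all pairs (\<open>card_large_prime_pairs_le\<close>). For fixed \<open>a\<close> this sum is the Chebyshev theta
  function at \<open>x / a\<^sup>2\<close>, hence at most \<open>2 * x / a\<^sup>2\<close>, and the sum of \<open>1 / a\<^sup>2\<close> converges.
  Weighting by \<open>ln p\<close> in this way makes the sum over \<open>a\<close> immediate, whereas the bound
  \<open>O(y / ln y)\<close> for the number of primes up to \<open>y = x / a\<^sup>2\<close> saves no factor \<open>ln x\<close> when \<open>a\<close>
  is close to \<open>sqrt x\<close>.

  The one arithmetic input is Chebyshev's upper bound, in the form that the product of the
  primes up to \<open>n\<close> is at most \<open>4 ^ n\<close> (\<open>primorial_le\<close>).
\<close>

section \<open>Chebyshev's upper bound\<close>

text \<open>
  By symmetry this coefficient occurs twice in its row, and the row sums to \<open>2 * 4 ^ m\<close>.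
\<close>

lemma central_binomial_odd_le: "(2 * m + 1) choose m \<le> (4::nat) ^ m"
proof -
  have "2 * ((2 * m + 1) choose m) = (\<Sum>k\<in>{m, m + 1}. (2 * m + 1) choose k)"
    using binomial_symmetric[of m "2 * m + 1"] by simp
  also have "\<dots> \<le> (\<Sum>k\<le>2 * m + 1. (2 * m + 1) choose k)"
    by (intro sum_mono2) auto
  also have "\<dots> = 2 * 4 ^ m"
    by (simp add: choose_row_sum power_mult del: sum.atMost_Suc)
  finally show ?thesis by simp
qed

lemma prod_primes_dvd:
  assumes "finite A" "\<And>p. p \<in> A \<Longrightarrow> prime p" "\<And>p. p \<in> A \<Longrightarrow> p dvd n"
  shows "\<Prod>A dvd (n::nat)"
  using assms
proof (induction A)
  case (insert p A)
  have "coprime p (\<Prod>A)"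
    using insert by (intro prod_coprime_right) (metis insertCI primes_coprime)
  then show ?case using insert by (simp add: divides_mult)
qed simp

text \<open>
  The primes in question divide the numerator of
  \<open>(2 * m + 1)! / (m! * (m + 1)!)\<close> but not its denominator.
\<close>

lemma prod_primes_upper_half_dvd:
  "\<Prod>{p::nat. prime p \<and> m + 1 < p \<and> p \<le> 2 * m + 1} dvd (2 * m + 1) choose m"
proof (rule prod_primes_dvd)
  fix p assume "p \<in> {p::nat. prime p \<and> m + 1 < p \<and> p \<le> 2 * m + 1}"
  then have p: "prime p" "m + 1 < p" "p \<le> 2 * m + 1" by auto
  have "fact m * fact (m + 1) * ((2 * m + 1) choose m) = (fact (2 * m + 1) :: nat)"
    using binomial_fact_lemma[of m "2 * m + 1"] by simp
  moreover have "p dvd fact (2 * m + 1)" "\<not> p dvd fact m" "\<not> p dvd fact (m + 1)"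
    using p by (auto simp: prime_dvd_fact_iff simp del: fact_Suc)
  ultimately show "p dvd (2 * m + 1) choose m"
    using p(1) by (metis prime_dvd_mult_iff)
qed auto

text \<open>
  For even \<open>n > 2\<close> the number \<open>n\<close> is not prime, so the product is the one for \<open>n - 1\<close>. For odd \<open>n = 2 * m + 1\<close> the primes up to
  \<open>m + 1\<close> contribute at most \<open>4 ^ (m + 1)\<close> by induction, and the others at most the binomial
  coefficient \<open>(2 * m + 1) choose m \<le> 4 ^ m\<close>.
\<close>

lemma primorial_le: "\<Prod>{p::nat. prime p \<and> p \<le> n} \<le> 4 ^ n"
proof (induction n rule: less_induct)
  case (less n)
  consider "n \<le> 1" | "n = 2" | "n > 2" "even n" | m where "m \<ge> 1" "n = 2 * m + 1"
    by (metis One_nat_def Suc_eq_plus1 evenE le_eq_less_or_eq linorder_not_le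
        mult_0_right not_less_eq_eq numeral_2_eq_2 oddE add_0 less_one)
  then show ?case
  proof cases
    case 1
    then have "{p::nat. prime p \<and> p \<le> n} = {}"
      by (auto dest: prime_gt_1_nat)
    then show ?thesis by (simp only: prod.empty) simp
  next
    case 2
    then have "{p::nat. prime p \<and> p \<le> n} = {2}"
      by (auto dest: prime_ge_2_nat)
    then show ?thesis using 2 by simp
  next
    case 3
    then have "\<not> prime n" using prime_odd_nat by blast
    then have "{p::nat. prime p \<and> p \<le> n} = {p. prime p \<and> p \<le> n - 1}"
      by (auto simp: le_less)
    moreover have "\<Prod>{p::nat. prime p \<and> p \<le> n - 1} \<le> 4 ^ (n - 1)"
      using less.IH 3 by simp
    moreover have "(4::nat) ^ (n - 1) \<le> 4 ^ n" by (intro power_increasing) auto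
    ultimately show ?thesis using le_trans by (simp only:)
  next
    case 4
    let ?A = "{p::nat. prime p \<and> p \<le> m + 1}"
    let ?B = "{p::nat. prime p \<and> m + 1 < p \<and> p \<le> 2 * m + 1}"
    have "{p::nat. prime p \<and> p \<le> n} = ?A \<union> ?B" using 4 by auto
    then have "\<Prod>{p::nat. prime p \<and> p \<le> n} = \<Prod>?A * \<Prod>?B"
      by (simp only:) (intro prod.union_disjoint, auto)
    also have "\<dots> \<le> 4 ^ (m + 1) * 4 ^ m"
    proof (intro mult_mono)
      show "\<Prod>?A \<le> 4 ^ (m + 1)" using less.IH[of "m + 1"] 4 by simp
      have "\<Prod>?B \<le> (2 * m + 1) choose m"
        by (intro dvd_imp_le prod_primes_upper_half_dvd) simp
      then show "\<Prod>?B \<le> 4 ^ m" using central_binomial_odd_le le_trans by blast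
    qed auto
    also have "\<dots> = 4 ^ n" using 4 by (simp add: power_add [symmetric] mult_2)
    finally show ?thesis .
  qed
qed

lemma sum_ln_primes_le:
  assumes "y \<ge> 0"
  shows "(\<Sum>p | prime (p::nat) \<and> real p \<le> y. ln (real p)) \<le> 2 * y"
proof -
  define n where "n = nat \<lfloor>y\<rfloor>"
  have le_n: "real p \<le> y \<longleftrightarrow> p \<le> n" for p
    using assms unfolding n_def by (simp add: le_nat_floor le_floor_iff nat_le_iff le_nat_iff)
  have n_le: "real n \<le> y" using assms unfolding n_def by simp
  have ln4: "ln (4::real) \<le> 2"
    using ln_realpow[of "2::real" 2] ln_add_one_self_le_self[of "1::real"] by simp
  have "(\<Sum>p | prime (p::nat) \<and> real p \<le> y. ln (real p))
      = ln (\<Prod>p | prime (p::nat) \<and> p \<le> n. real p)"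
    unfolding le_n by (subst ln_prod) (auto dest: prime_gt_0_nat)
  also have "\<dots> = ln (real (\<Prod>{p::nat. prime p \<and> p \<le> n}))" by simp
  also have "\<dots> \<le> ln (real (4 ^ n))"
  proof (subst ln_le_cancel_iff)
    show "0 < real (\<Prod>{p::nat. prime p \<and> p \<le> n})"
      by (simp, intro prod_pos) (auto dest: prime_gt_0_nat)
    show "real (\<Prod>{p::nat. prime p \<and> p \<le> n}) \<le> real (4 ^ n)"
      using primorial_le[of n] by (simp only: of_nat_le_iff)
  qed simp
  also have "\<dots> = real n * ln 4" by (simp add: ln_realpow)
  also have "\<dots> \<le> y * 2" using n_le ln4 assms by (intro mult_mono) auto
  finally show ?thesis by simp
qed

section \<open>Counting SP numbers\<close>

text \<open>Each new term is at most \<open>1 / n - 1 / (n + 1)\<close>, so the sum telescopes.\<close>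

lemma sum_inverse_squares_le:
  assumes "n \<ge> 1"
  shows "(\<Sum>a = 1..n. 1 / (real a)\<^sup>2) \<le> 2 - 1 / real n"
  using assms
proof (induction n rule: dec_induct)
  case (step n)
  have "1 / (real (Suc n))\<^sup>2 \<le> 1 / (real n * real (Suc n))"
    using step by (intro divide_left_mono) (auto simp: power2_eq_square)
  also have "\<dots> = 1 / real n - 1 / real (Suc n)"
    using step by (simp add: field_simps)
  finally show ?case using step by simp
qed simp

lemma card_pos_nats_le:
  assumes "y \<ge> 0"
  shows "finite {n::nat. 1 \<le> n \<and> real n \<le> y}" "real (card {n::nat. 1 \<le> n \<and> real n \<le> y}) \<le> y"
proof -
  have eq: "{n::nat. 1 \<le> n \<and> real n \<le> y} = {1..nat \<lfloor>y\<rfloor>}"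
    using assms by (auto simp: le_nat_floor le_nat_iff le_floor_iff)
  show "finite {n::nat. 1 \<le> n \<and> real n \<le> y}" unfolding eq by simp
  show "real (card {n::nat. 1 \<le> n \<and> real n \<le> y}) \<le> y"
    unfolding eq using assms by simp
qed

text \<open>
  The case \<open>a = 1\<close>, in which \<open>p * a\<^sup>2\<close> is not an SP number, is included: it does not
  change the order of magnitude.
\<close>

definition prime_square_pairs :: "real \<Rightarrow> (nat \<times> nat) set" where
  "prime_square_pairs x = {(p, a). prime p \<and> 1 \<le> a \<and> real p * (real a)\<^sup>2 \<le> x}"

lemma prime_square_pairs_bounds:
  assumes "(p, a) \<in> prime_square_pairs x"
  shows "1 \<le> p" "1 \<le> a" "real p \<le> x" "real a \<le> sqrt x"
proof -
  have p: "prime p" and a: "1 \<le> a" and le: "real p * (real a)\<^sup>2 \<le> x"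
    using assms by (auto simp: prime_square_pairs_def)
  show "1 \<le> a" by (fact a)
  show p1: "1 \<le> p" using prime_ge_1_nat[OF p] .
  have "real p * 1 \<le> real p * (real a)\<^sup>2" using a by (intro mult_left_mono) auto
  then show "real p \<le> x" using le by simp
  have "1 * (real a)\<^sup>2 \<le> real p * (real a)\<^sup>2" using p1 by (intro mult_right_mono) auto
  then show "real a \<le> sqrt x" using le by (intro real_le_rsqrt) simp
qed

lemma finite_prime_square_pairs: "finite (prime_square_pairs x)"
proof (rule finite_subset)
  show "prime_square_pairs x \<subseteq> {..nat \<lfloor>x\<rfloor>} \<times> {..nat \<lfloor>sqrt x\<rfloor>}"
    by (auto dest: prime_square_pairs_bounds intro: le_nat_floor)
qed simp

lemma card_small_prime_pairs_le:
  assumes "x > 0"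
  shows "real (card {(p, a) \<in> prime_square_pairs x. real p \<le> x powr (1/4)}) \<le> x powr (3/4)"
proof -
  let ?P = "{n::nat. 1 \<le> n \<and> real n \<le> x powr (1/4)}"
  let ?A = "{n::nat. 1 \<le> n \<and> real n \<le> sqrt x}"
  have sq: "sqrt x \<ge> 0" using assms by simp
  have fin: "finite ?P" "finite ?A"
    using card_pos_nats_le(1) sq by auto
  have "{(p, a) \<in> prime_square_pairs x. real p \<le> x powr (1/4)} \<subseteq> ?P \<times> ?A"
    by (auto dest: prime_square_pairs_bounds simp del: One_nat_def)
  then have "card {(p, a) \<in> prime_square_pairs x. real p \<le> x powr (1/4)} \<le> card (?P \<times> ?A)"
    using fin by (intro card_mono) auto
  then have "real (card {(p, a) \<in> prime_square_pairs x. real p \<le> x powr (1/4)})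
      \<le> real (card ?P) * real (card ?A)"
    by (simp only: card_cartesian_product flip: of_nat_mult of_nat_le_iff)
  also have "\<dots> \<le> x powr (1/4) * sqrt x"
    using card_pos_nats_le(2) sq by (intro mult_mono) auto
  also have "\<dots> = x powr (3/4)"
    using assms by (simp add: powr_half_sqrt[symmetric] powr_add[symmetric])
  finally show ?thesis .
qed

text \<open>
  For each \<open>a\<close>, Chebyshev's bound at \<open>x / a\<^sup>2\<close> contributes at most \<open>2 * x / a\<^sup>2\<close>, and the
  sum of \<open>1 / a\<^sup>2\<close> is at most \<open>2\<close>.
\<close>

lemma sum_ln_prime_square_pairs_le:
  assumes "x > 0"
  shows "(\<Sum>(p, a)\<in>prime_square_pairs x. ln (real p)) \<le> 4 * x"
proof -
  define N where "N = nat \<lfloor>sqrt x\<rfloor>"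
  have fin: "finite {p::nat. prime p \<and> real p \<le> y}" for y
    by (rule finite_subset[of _ "{..nat \<lfloor>y\<rfloor>}"]) (auto intro: le_nat_floor)
  have eq: "prime_square_pairs x
      = prod.swap ` (SIGMA a:{1..N}. {p. prime p \<and> real p \<le> x / (real a)\<^sup>2})"
  proof (intro equalityI subsetI)
    fix z assume z: "z \<in> prime_square_pairs x"
    obtain p a where pa: "z = (p, a)" by (cases z)
    have "a \<le> N" unfolding N_def
      using prime_square_pairs_bounds(4) z pa by (intro le_nat_floor) auto
    then show "z \<in> prod.swap ` (SIGMA a:{1..N}. {p. prime p \<and> real p \<le> x / (real a)\<^sup>2})"
      using z pa by (intro image_eqI[of _ _ "(a, p)"])
        (auto simp: prime_square_pairs_def field_simps)
  qed (auto simp: prime_square_pairs_def field_simps)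
  have "(\<Sum>(p, a)\<in>prime_square_pairs x. ln (real p))
      = (\<Sum>(a, p)\<in>(SIGMA a:{1..N}. {p. prime p \<and> real p \<le> x / (real a)\<^sup>2}). ln (real p))"
    unfolding eq by (subst sum.reindex) (auto simp: case_prod_beta)
  also have "\<dots> = (\<Sum>a = 1..N. \<Sum>p | prime p \<and> real p \<le> x / (real a)\<^sup>2. ln (real p))"
    using fin by (subst sum.Sigma) auto
  also have "\<dots> \<le> (\<Sum>a = 1..N. 2 * (x / (real a)\<^sup>2))"
    using assms by (intro sum_mono sum_ln_primes_le) auto
  also have "\<dots> = 2 * x * (\<Sum>a = 1..N. 1 / (real a)\<^sup>2)"
    by (simp add: sum_distrib_left)
  also have "\<dots> \<le> 2 * x * 2"
  proof (rule mult_left_mono)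
    have "0 \<le> 1 / real N" by simp
    then show "(\<Sum>a = 1..N. 1 / (real a)\<^sup>2) \<le> 2"
      using sum_inverse_squares_le[of N] by (cases "N = 0") (simp, linarith)
  qed (use assms in simp)
  finally show ?thesis by simp
qed

text \<open>
  Each of these pairs has \<open>ln p > ln x / 4\<close>, so their number is at most \<open>4 / ln x\<close> times the
  sum of \<open>ln p\<close>.
\<close>

lemma card_large_prime_pairs_le:
  assumes "x > 1"
  shows "real (card {(p, a) \<in> prime_square_pairs x. real p > x powr (1/4)}) \<le> 16 * x / ln x"
proof -
  let ?L = "{(p, a) \<in> prime_square_pairs x. real p > x powr (1/4)}"
  have "real (card ?L) * (ln x / 4) = (\<Sum>z\<in>?L. ln x / 4)" by simp
  also have "\<dots> \<le> (\<Sum>(p, a)\<in>?L. ln (real p))"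
  proof (intro sum_mono, clarify)
    fix p a assume "x powr (1/4) < real p"
    then have "ln (x powr (1/4)) \<le> ln (real p)"
      using assms by (intro ln_mono) auto
    then show "ln x / 4 \<le> ln (real p)" using assms by (simp add: ln_powr)
  qed
  also have "\<dots> \<le> (\<Sum>(p, a)\<in>prime_square_pairs x. ln (real p))"
    by (intro sum_mono2 finite_prime_square_pairs)
       (auto intro!: ln_ge_zero dest: prime_square_pairs_bounds(1))
  also have "\<dots> \<le> 4 * x" using assms by (intro sum_ln_prime_square_pairs_le) simp
  finally show ?thesis using assms by (simp add: field_simps)
qed

lemma SP_numbers_le:
  "finite {n. SP_number n \<and> real n \<le> x}"
  "card {n. SP_number n \<and> real n \<le> x} \<le> card (prime_square_pairs x)"
proof -
  have sub: "{n. SP_number n \<and> real n \<le> x} \<subseteq> (\<lambda>(p, a). p * a\<^sup>2) ` prime_square_pairs x"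
  proof
    fix n assume "n \<in> {n. SP_number n \<and> real n \<le> x}"
    then obtain p a where "prime p" "a \<ge> 2" "n = p * a\<^sup>2" "real n \<le> x"
      by (auto simp: SP_number_def)
    then show "n \<in> (\<lambda>(p, a). p * a\<^sup>2) ` prime_square_pairs x"
      by (intro image_eqI[of _ _ "(p, a)"]) (auto simp: prime_square_pairs_def)
  qed
  show "finite {n. SP_number n \<and> real n \<le> x}"
    using finite_subset[OF sub] finite_prime_square_pairs by blast
  show "card {n. SP_number n \<and> real n \<le> x} \<le> card (prime_square_pairs x)"
    using surj_card_le[OF finite_prime_square_pairs sub] .
qed

text \<open>
  The inequality \<open>ln y \<le> y\<close> at \<open>y = x powr (1/4)\<close> shows that \<open>x powr (3/4)\<close>, the contribution
  of the small primes, is at most \<open>4 * x / ln x\<close>.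
\<close>

lemma card_SP_numbers_le:
  assumes "x > 1"
  shows "real (card {n. SP_number n \<and> real n \<le> x}) \<le> 20 * x / ln x"
proof -
  let ?S = "{(p, a) \<in> prime_square_pairs x. real p \<le> x powr (1/4)}"
  let ?L = "{(p, a) \<in> prime_square_pairs x. real p > x powr (1/4)}"
  have "prime_square_pairs x = ?S \<union> ?L" by auto
  then have "card (prime_square_pairs x) \<le> card ?S + card ?L"
    using card_Un_le[of ?S ?L] by simp
  with SP_numbers_le(2)[of x] have
    "real (card {n. SP_number n \<and> real n \<le> x}) \<le> real (card ?S) + real (card ?L)"
    by linarith
  also have "\<dots> \<le> x powr (3/4) + 16 * x / ln x"
    using assms by (intro add_mono card_small_prime_pairs_le card_large_prime_pairs_le) auto
  also have "x powr (3/4) \<le> 4 * x / ln x"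
  proof -
    have "ln (x powr (1/4)) \<le> x powr (1/4)"
      using assms ln_less_self[of "x powr (1/4)"] by simp
    then have "ln x \<le> 4 * x powr (1/4)" using assms by (simp add: ln_powr)
    then have "x powr (3/4) * ln x \<le> x powr (3/4) * (4 * x powr (1/4))"
      by (intro mult_left_mono) auto
    also have "\<dots> = 4 * x" using assms by (simp add: powr_add[symmetric])
    finally show ?thesis using assms by (simp add: field_simps)
  qed
  finally show ?thesis by (simp add: field_simps)
qed

section \<open>Counting fractions\<close>

lemma SPFarey_le: "SPFarey x \<le> (card {n. SP_number n \<and> real n \<le> x})\<^sup>2"
proof -
  let ?S = "{n. SP_number n \<and> real n \<le> x}"
  have "SPFarey_set x \<subseteq> (\<lambda>(s, t). of_nat s / of_nat t) ` (?S \<times> ?S)"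
    by (force simp: SPFarey_set_def)
  then have "card (SPFarey_set x) \<le> card (?S \<times> ?S)"
    by (intro surj_card_le finite_cartesian_product SP_numbers_le(1))
  then show ?thesis by (simp add: SPFarey_def card_cartesian_product power2_eq_square)
qed

theorem theorem3p1:
  shows "(\<lambda>x::real. real (SPFarey x)) \<in> O[at_top](\<lambda>x. x ^ 2 / (ln x) ^ 2)"
proof (rule bigoI[of _ 400])
  show "\<forall>\<^sub>F x in at_top. norm (real (SPFarey x)) \<le> 400 * norm (x ^ 2 / (ln x) ^ 2)"
    using eventually_gt_at_top[of 1]
  proof eventually_elim
    case (elim x)
    have "real (SPFarey x) \<le> real ((card {n. SP_number n \<and> real n \<le> x})\<^sup>2)"
      using SPFarey_le by (simp only: of_nat_le_iff)
    also have "\<dots> = (real (card {n. SP_number n \<and> real n \<le> x}))\<^sup>2" by simp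
    also have "\<dots> \<le> (20 * x / ln x)\<^sup>2"
      by (intro power_mono card_SP_numbers_le elim) simp
    finally show ?case by (simp add: power_divide power_mult_distrib)
  qed
qed

end
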